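(* Let $n\ge 3$ be an integer. Then the following three conditions are equivalent: (i) $f(n)\ne L(n)$; (ii) $f(n)=L(n)-1$; (iii) $\binom{n}{L(n)-1}>\frac{2^n}{n+1}$.
   Context: For an integer $n\ge 3$, $f(n)$ denotes the least positive integer $k$ such that $\binom{n}{k}>\frac{2^n}{n+1}$, and $L(n)$ denotes the least positive integer $k$ such that $\binom{n}{k}>\frac{2^n}{n}$. (Such $k$ exist for all $n\ge 3$.) *)

theory Defs
  imports Complex_Main
begin

(* LEAST is only meaningful when a witness exists; for both definitions one does for every n >= 3. *)

definition f_index :: "nat \<Rightarrow> nat" where
  "f_index n = (LEAST k. k > 0 \<and> real (n choose k) > 2 ^ n / (real n + 1))"

definition L_index :: "nat \<Rightarrow> nat" where
  "L_index n = (LEAST k. k > 0 \<and> real (n choose k) > 2 ^ n / real n)"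

end

theory Submission
  imports Defs
begin

text \<open>
  Write \<open>f = f_index n\<close> and \<open>L = L_index n\<close>. The threshold for \<open>L\<close> is the larger one, so \<open>f \<le> L\<close>,
  and the whole content is that \<open>f\<close> cannot lag behind by more than one, i.e. \<open>L \<le> f + 1\<close>.
  Left of the middle of a row of Pascal's triangle, consecutive entries grow by at least the
  factor \<open>(n + 1) / n\<close> (lemma \<open>binomial_growth_below_middle\<close>), which is exactly the quotient of the
  two thresholds: one step to the right of an entry above \<open>2 ^ n / (n + 1)\<close> stands an entry above
  \<open>2 ^ n / n\<close>. If \<open>f\<close> is not left of the middle, then \<open>L \<le> f\<close>, because the middle entry
  already exceeds \<open>2 ^ n / n\<close> (lemma \<open>middle_binomial_gt\<close>).

  Hence \<open>f\<close> is \<open>L\<close> or \<open>L - 1\<close>, and by minimality of \<open>f\<close> the second case occurs exactly when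
  the entry at \<open>L - 1\<close> exceeds the smaller threshold. If \<open>L = 1\<close>, the index \<open>L - 1 = 0\<close> is not a
  candidate for \<open>f\<close>, but then the entry is \<open>1\<close>, which does not exceed \<open>2 ^ n / (n + 1)\<close>.
\<close>

text \<open>
  The ratio of the two entries is \<open>(n - k) / (k + 1)\<close>, so the claim is
  \<open>(n + 1) (k + 1) \<le> n (n - k)\<close>. In terms of the distance \<open>d = n - 2 (k + 1)\<close> the difference
  of the two sides is \<open>n (d + 1) - (k + 1)\<close>, which is nonnegative since \<open>k + 1 \<le> n\<close>.
\<close>

lemma binomial_growth_below_middle:
  fixes n k :: nat
  assumes "k < n div 2"
  shows "(n + 1) * (n choose k) \<le> n * (n choose Suc k)"
proof -
  have "2 * (k + 1) \<le> n"
    using assms by presburger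
  then obtain d where n: "n = 2 * (k + 1) + d"
    using le_Suc_ex by blast
  have step: "Suc k * (n choose Suc k) = (n - k) * (n choose k)"
    by (simp only: binomial_absorb_comp binomial_absorption)
  have "(n + 1) * Suc k \<le> n * (n - k)"
    by (simp add: n algebra_simps)
  then have "(n + 1) * Suc k * (n choose k) \<le> n * (n - k) * (n choose k)"
    by (rule mult_right_mono) simp
  also have "\<dots> = n * (Suc k * (n choose Suc k))"
    by (simp only: step mult.assoc)
  finally have "Suc k * ((n + 1) * (n choose k)) \<le> Suc k * (n * (n choose Suc k))"
    by (simp only: mult_ac)
  then show ?thesis
    by (simp only: Suc_mult_le_cancel1)
qed

text \<open>
  Bounding all \<open>n + 1\<close> entries of the row by the middle one only gives the threshold
  \<open>2 ^ n / (n + 1)\<close>. The two outer entries sum to \<open>2\<close>, which is less than a single middle entry,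
  so one of the \<open>n + 1\<close> summands is saved and the inequality is strict.
\<close>

lemma middle_binomial_gt:
  fixes n :: nat
  assumes "n \<ge> 3"
  shows "2 ^ n < n * (n choose (n div 2))"
proof -
  let ?M = "n choose (n div 2)"
  have "n choose 1 \<le> ?M"
    by (rule binomial_maximum)
  then have big: "2 < ?M"
    using assms by simp
  obtain m where m: "n = Suc m"
    using assms by (cases n) auto
  have "2 ^ n = (\<Sum>k\<le>n. n choose k)"
    by (simp add: choose_row_sum)
  also have "\<dots> = (n choose 0) + (\<Sum>k<Suc m. n choose Suc k)"
    by (simp only: m sum.atMost_Suc_shift lessThan_Suc_atMost)
  also have "\<dots> = 2 + (\<Sum>k<m. n choose Suc k)"
    by (simp add: m del: binomial_Suc_Suc)
  also have "\<dots> \<le> 2 + (\<Sum>k<m. ?M)"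
    by (intro add_left_mono sum_mono binomial_maximum)
  also have "\<dots> < n * ?M"
    using big by (simp add: m)
  finally show ?thesis .
qed

lemma middle_binomial_exceeds:
  fixes n :: nat
  assumes "n \<ge> 3"
  shows "n div 2 > 0 \<and> real (n choose (n div 2)) > 2 ^ n / real n"
proof -
  have "real (2 ^ n) < real (n * (n choose (n div 2)))"
    using middle_binomial_gt[OF assms] by (simp only: of_nat_less_iff)
  then show ?thesis
    using assms by (simp add: divide_less_eq mult.commute)
qed

lemma L_index_props:
  fixes n :: nat
  assumes "n \<ge> 3"
  shows "L_index n > 0" and "real (n choose L_index n) > 2 ^ n / real n"
  using LeastI[of "\<lambda>k. k > 0 \<and> real (n choose k) > 2 ^ n / real n",
      OF middle_binomial_exceeds[OF assms]]
  unfolding L_index_def by auto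

lemma L_index_le:
  assumes "k > 0" and "real (n choose k) > 2 ^ n / real n"
  shows "L_index n \<le> k"
  unfolding L_index_def using assms by (intro Least_le) simp

lemma f_index_le:
  assumes "k > 0" and "real (n choose k) > 2 ^ n / (real n + 1)"
  shows "f_index n \<le> k"
  unfolding f_index_def using assms by (intro Least_le) simp

lemma f_threshold_if_L_threshold:
  assumes "n > 0" and "real (n choose k) > 2 ^ n / real n"
  shows "real (n choose k) > 2 ^ n / (real n + 1)"
proof -
  have "2 ^ n / (real n + 1) \<le> 2 ^ n / real n"
    using assms(1) by (intro divide_left_mono) auto
  then show ?thesis
    using assms(2) by linarith
qed

lemma f_index_props:
  fixes n :: nat
  assumes "n \<ge> 3"
  shows "f_index n > 0" and "real (n choose f_index n) > 2 ^ n / (real n + 1)"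
proof -
  have "L_index n > 0 \<and> real (n choose L_index n) > 2 ^ n / (real n + 1)"
    using L_index_props[OF assms] f_threshold_if_L_threshold assms by simp
  from LeastI[of "\<lambda>k. k > 0 \<and> real (n choose k) > 2 ^ n / (real n + 1)", OF this]
  show "f_index n > 0" and "real (n choose f_index n) > 2 ^ n / (real n + 1)"
    unfolding f_index_def by auto
qed

lemma f_index_le_L_index:
  fixes n :: nat
  assumes "n \<ge> 3"
  shows "f_index n \<le> L_index n"
  using L_index_props[OF assms] f_threshold_if_L_threshold assms by (intro f_index_le) simp_all

lemma L_threshold_next:
  assumes "k < n div 2" and "real (n choose k) > 2 ^ n / (real n + 1)"
  shows "real (n choose Suc k) > 2 ^ n / real n"
proof -
  have n: "n > 0"
    using assms(1) by (cases n) auto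
  have "2 ^ n < (real n + 1) * real (n choose k)"
    using assms(2) by (simp add: divide_less_eq add_pos_nonneg mult.commute)
  also have "\<dots> = real ((n + 1) * (n choose k))"
    by (simp add: algebra_simps)
  also have "\<dots> \<le> real (n * (n choose Suc k))"
    using binomial_growth_below_middle[OF assms(1)] by (simp only: of_nat_le_iff)
  finally show ?thesis
    using n by (simp add: divide_less_eq mult.commute)
qed

lemma L_index_le_Suc_f_index:
  fixes n :: nat
  assumes "n \<ge> 3"
  shows "L_index n \<le> Suc (f_index n)"
proof (cases "f_index n < n div 2")
  case True
  then show ?thesis
    using L_threshold_next f_index_props(2)[OF assms] by (intro L_index_le) simp_all
next
  case False
  moreover have "L_index n \<le> n div 2"
    using middle_binomial_exceeds[OF assms] by (intro L_index_le) simp_all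
  ultimately show ?thesis
    by simp
qed

theorem corollary1p1:
  fixes n :: nat
  assumes "n \<ge> 3"
  shows "(f_index n \<noteq> L_index n \<longleftrightarrow> f_index n = L_index n - 1) \<and>
         (f_index n = L_index n - 1 \<longleftrightarrow>
            real (n choose (L_index n - 1)) > 2 ^ n / (real n + 1))"
proof -
  have Lpos: "L_index n > 0"
    by (rule L_index_props(1)[OF assms])
  have cases: "f_index n = L_index n \<or> f_index n = L_index n - 1"
    using f_index_le_L_index[OF assms] L_index_le_Suc_f_index[OF assms] by linarith
  have "f_index n = L_index n - 1"
    if above: "real (n choose (L_index n - 1)) > 2 ^ n / (real n + 1)"
  proof -
    have "L_index n - 1 \<noteq> 0"
    proof
      assume "L_index n - 1 = 0"
      with above have "2 ^ n < real n + 1"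
        by (simp add: divide_less_eq add_pos_nonneg)
      moreover have "real (n + 1) \<le> real (2 ^ n)"
        using less_exp[of n] by (simp only: of_nat_le_iff)
      ultimately show False
        by simp
    qed
    then have "f_index n \<le> L_index n - 1"
      using above by (intro f_index_le) simp_all
    then show ?thesis
      using cases Lpos by linarith
  qed
  moreover have "real (n choose (L_index n - 1)) > 2 ^ n / (real n + 1)"
    if "f_index n = L_index n - 1"
    using f_index_props(2)[OF assms] that by simp
  moreover have "f_index n \<noteq> L_index n \<longleftrightarrow> f_index n = L_index n - 1"
    using cases Lpos by linarith
  ultimately show ?thesis
    by blast
qed

end
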